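(* Let $c$ and $b$ be odd integers with $1\leq c\leq 9$ and $3\leq b\leq 9$, and let $u\in U_{[c,b]}$. Then there exist arbitrarily long finite sequences of consecutive $u$-attracted numbers for $S_{[c,b]}$.
   Context: For integers $c\ge 0$, $b\ge 2$, the function $S_{[c,b]}:\mathbb{Z}^+\to\mathbb{Z}^+$ is defined by $S_{[c,b]}(a)=c+\sum_{i=0}^n a_i^2$, where $a=\sum_{i=0}^n a_i b^i$ with integers $0\le a_i\le b-1$ is the base-$b$ expansion of the positive integer $a$. $S_{[c,b]}^k$ denotes the $k$-fold iterate ($S_{[c,b]}^0$ is the identity). $U_{[c,b]}=\{a\in\mathbb{Z}^+ \mid S_{[c,b]}^m(a)=a \text{ for some } m\in\mathbb{Z}^+\}$ is the set of all elements of fixed points and cycles of $S_{[c,b]}$. For $u\in U_{[c,b]}$, a positive integer $a$ is a $u$-attracted number (for $S_{[c,b]}$) if $S_{[c,b]}^k(a)=u$ for some $k\in\mathbb{Z}_{\ge 0}$. "Arbitrarily long" means: for every $N\in\mathbb{Z}^+$ there are $N$ consecutive positive integers all of which are $u$-attracted. *)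

theory Defs
  imports Complex_Main
begin

(* Digits of a in base b, least significant first. The guard on b only serves termination. *)
function base_digits :: "nat \<Rightarrow> nat \<Rightarrow> nat list" where
  "base_digits b a =
     (if b < 2 \<or> a = 0 then [] else (a mod b) # base_digits b (a div b))"
  by pat_completeness auto
termination
  by (relation "measure snd") auto

declare base_digits.simps [simp del]

(* Positive integers are the nonzero elements of nat; positivity is imposed in U_set and
   attracted, so the value at 0 is irrelevant to both. *)
definition S :: "nat \<Rightarrow> nat \<Rightarrow> nat \<Rightarrow> nat" where
  "S c b a = c + (\<Sum>d\<leftarrow>base_digits b a. d\<^sup>2)"

definition U_set :: "nat \<Rightarrow> nat \<Rightarrow> nat set" where
  "U_set c b = {a. a > 0 \<and> (\<exists>m>0. (S c b ^^ m) a = a)}"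

definition attracted :: "nat \<Rightarrow> nat \<Rightarrow> nat \<Rightarrow> nat \<Rightarrow> bool" where
  "attracted c b u a \<longleftrightarrow> a > 0 \<and> (\<exists>k. (S c b ^^ k) a = u)"

lemma S_0: "S c b 0 = c"
  by (simp add: S_def base_digits.simps)

lemma S_rec:
  assumes "b \<ge> 2" and "r < b"
  shows "S c b (r + b * q) = r\<^sup>2 + S c b q"
proof (cases "r + b * q = 0")
  case True
  with assms show ?thesis by (simp add: S_0)
next
  case False
  with assms show ?thesis by (auto simp add: S_def base_digits.simps [of b "r + b * q"])
qed

(* The value of S read off from any base b expansion of a, with or without leading zeros. *)
lemma S_expansion:
  assumes "b \<ge> 2" and "\<And>i. i \<le> n \<Longrightarrow> d i < b" and "a = (\<Sum>i=0..n. d i * b ^ i)"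
  shows "S c b a = c + (\<Sum>i=0..n. (d i)\<^sup>2)"
  using assms(2,3)
proof (induction n arbitrary: a d)
  case 0
  then show ?case using S_rec [OF assms(1), of "d 0" c 0] by (simp add: S_0)
next
  case (Suc n)
  have "a = d 0 + b * (\<Sum>i=0..n. d (Suc i) * b ^ i)"
    unfolding Suc.prems(2) sum.atLeast0_atMost_Suc_shift
    by (simp add: sum_distrib_left algebra_simps)
  then show ?case
    using S_rec [OF assms(1) Suc.prems(1) [of 0], of c "\<Sum>i=0..n. d (Suc i) * b ^ i"]
      Suc.IH [of "\<lambda>i. d (Suc i)", OF _ refl] Suc.prems(1)
    by (simp add: sum.atLeast0_atMost_Suc_shift del: sum.cl_ivl_Suc)
qed

end

theory Submission
  imports Defs "HOL-Library.Code_Binary_Nat"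
begin

text \<open>Call a finite set good if some positive translate of it consists of attracted numbers.
  Goodness of an image under translation or under \<open>S\<close> implies goodness of the set itself. Two
  numbers of equal parity can be shifted so that their images agree modulo \<open>b - 1\<close>, and after one
  more shift the next images coincide; so every finite set shrinks to at most two numbers, of
  opposite parity. By the same device such a pair can be brought to the form \<open>t, t + 1\<close>, and any
  such pair can be shifted to one with images \<open>a, a + 1\<close> for a prescribed \<open>a > c\<close>. Hence a single
  pair of consecutive attracted numbers above \<open>c\<close> suffices, and it is found by computation for
  each of the finitely many cycles.\<close>

section \<open>Digit concatenation and parity for sums of squared digits\<close>

lemma S_eq_add: "S c b a = c + S 0 b a"
  by (simp add: S_def)

lemma ex_power_gt_nat:
  assumes "b \<ge> 2"
  shows "\<exists>r>0. (x::nat) < b ^ r"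
proof -
  have "x < 2 ^ Suc x"
    using less_exp [of "Suc x"] by linarith
  also have "\<dots> \<le> b ^ Suc x"
    using assms by (rule power_mono) simp
  finally show ?thesis by blast
qed

text \<open>\<open>x\<close> fills the lowest \<open>r\<close> places and \<open>q\<close> the
  places above, so the sums of squares add; \<open>S 0\<close> keeps \<open>c\<close> from being
  counted twice.\<close>

lemma S_add_high:
  assumes "b \<ge> 2" and "x < b ^ r"
  shows "S c b (x + b ^ r * q) = S c b x + S 0 b q"
  using assms(2)
proof (induction r arbitrary: x)
  case 0
  then show ?case by (simp add: S_0 S_eq_add [of c])
next
  case (Suc r)
  have *: "x mod b < b" using assms(1) by simp
  have "x div b < b ^ r"
    using Suc.prems assms(1) by (simp add: less_mult_imp_div_less mult.commute)
  note IH = Suc.IH [OF this]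
  have "x + b ^ Suc r * q = x mod b + b * (x div b + b ^ r * q)"
    by (simp add: algebra_simps flip: add.assoc)
  then have "S c b (x + b ^ Suc r * q) = (x mod b)\<^sup>2 + (S c b (x div b) + S 0 b q)"
    using S_rec [OF assms(1) *, of c "x div b + b ^ r * q"] IH by simp
  also have "(x mod b)\<^sup>2 + S c b (x div b) = S c b x"
    using S_rec [OF assms(1) *, of c "x div b"] by simp
  ultimately show ?case by simp
qed

lemma S_digit: "b \<ge> 2 \<Longrightarrow> d < b \<Longrightarrow> S c b d = c + d\<^sup>2"
  using S_rec [of b d c 0] by (simp add: S_0)

text \<open>The numeral with \<open>m\<close> digits 1 is a witness; each induction step appends one
  more.\<close>

lemma ex_S_0_eq:
  assumes "b \<ge> 2"
  shows "\<exists>q. S 0 b q = m"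
proof (induction m)
  case 0
  show ?case using S_0 by blast
next
  case (Suc m)
  then obtain q where "S 0 b q = m" by blast
  with assms S_rec [of b 1 0 q] have "S 0 b (1 + b * q) = Suc m" by simp
  then show ?case by blast
qed

text \<open>For odd \<open>b\<close> all place values are odd, and a digit has the parity of its
  square, so both sides express the parity of the digit sum.\<close>

lemma even_S_0_iff:
  assumes "odd b" and "b \<ge> 2"
  shows "even (S 0 b a) \<longleftrightarrow> even a"
proof (induction a rule: less_induct)
  case (less a)
  show ?case
  proof (cases "a = 0")
    case False
    define q r where "q = a div b" and "r = a mod b"
    then have a: "a = r + b * q" and "r < b" and "q < a"
      using False assms(2) by simp_all
    have "even (S 0 b (r + b * q)) \<longleftrightarrow> even (r + b * q)"
      using less.IH [OF \<open>q < a\<close>] S_rec [OF assms(2) \<open>r < b\<close>, of 0 q] assms(1) by simp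
    then show ?thesis unfolding a .
  qed (simp add: S_0)
qed

section \<open>Good sets and the pullback of goodness\<close>

definition good :: "nat \<Rightarrow> nat \<Rightarrow> nat \<Rightarrow> nat set \<Rightarrow> bool" where
  "good c b u T \<longleftrightarrow> (\<exists>n>0. \<forall>t\<in>T. attracted c b u (t + n))"

lemma good_subset: "good c b u T \<Longrightarrow> T' \<subseteq> T \<Longrightarrow> good c b u T'"
  unfolding good_def by blast

lemma good_shift:
  assumes "good c b u ((\<lambda>t. t + n) ` T)"
  shows "good c b u T"
proof -
  from assms obtain m where "m > 0" "\<forall>t\<in>T. attracted c b u (t + (n + m))"
    unfolding good_def by (auto simp: add.assoc)
  then show ?thesis
    unfolding good_def by (intro exI [of _ "n + m"]) simp
qed

lemma attracted_S:
  assumes "attracted c b u (S c b a)" and "a > 0"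
  shows "attracted c b u a"
proof -
  from assms(1) obtain k where "(S c b ^^ k) (S c b a) = u"
    unfolding attracted_def by blast
  then have "(S c b ^^ Suc k) a = u"
    by (simp add: funpow_swap1)
  with assms(2) show ?thesis
    unfolding attracted_def by blast
qed

text \<open>A shift of the image is realised by prepending digits to the arguments whose squares
  sum to the shift.\<close>

lemma good_image:
  assumes "b \<ge> 2" and "finite T" and "good c b u (S c b ` T)"
  shows "good c b u T"
proof -
  from assms(3) obtain n where n: "n > 0" "\<And>t. t \<in> T \<Longrightarrow> attracted c b u (S c b t + n)"
    unfolding good_def by blast
  \<comment> \<open>Inserting 0 makes \<open>Max\<close> meaningful for empty
    \<open>T\<close>.\<close>
  from ex_power_gt_nat [OF assms(1)] obtain r where r: "Max (insert 0 T) < b ^ r"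
    by blast
  from ex_S_0_eq [OF assms(1)] obtain q where q: "S 0 b q = n"
    by blast
  with n(1) have "q > 0"
    by (cases "q = 0") (auto simp: S_0)
  with assms(1) have pos: "b ^ r * q > 0" by simp
  have "attracted c b u (t + b ^ r * q)" if "t \<in> T" for t
  proof (rule attracted_S)
    have "t \<le> Max (insert 0 T)"
      using assms(2) that by simp
    with r have "t < b ^ r" by simp
    from S_add_high [OF assms(1) this] n(2) [OF that] q
    show "attracted c b u (S c b (t + b ^ r * q))" by simp
    show "t + b ^ r * q > 0" using pos by simp
  qed
  with pos show ?thesis
    unfolding good_def by blast
qed

lemma good_step:
  assumes "b \<ge> 2" and "finite T" and "good c b u ((\<lambda>t. S c b (t + n)) ` T)"
  shows "good c b u T"
  using good_shift [of c b u n T] good_image [of b "(\<lambda>t. t + n) ` T" c u] assms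
  by (simp add: image_image)

section \<open>Controlling the images of two numbers by a common shift\<close>

text \<open>Shift so that the two numbers have the expansions \<open>10\<dots>0v\<close> and \<open>10\<dots>0v\<rho>\<close>.\<close>

lemma ex_shift_S_diff:
  assumes "b \<ge> 2" and "d < b" and "y = x + (b - 1) * v + d"
  shows "\<exists>n. S c b (y + n) = S c b (x + n) + d\<^sup>2"
proof -
  obtain r where r: "x + v < b ^ r"
    using ex_power_gt_nat [OF assms(1)] by blast
  \<comment> \<open>The leading 1 sits at place \<open>Suc r\<close>, leaving room for
    \<open>v\<close> followed by \<open>d\<close>; adding \<open>(b - 1) * v\<close> is what turns
    \<open>v\<close> into \<open>b * v\<close>.\<close>
  define n where "n = b ^ Suc r + v - x"
  have "b ^ r \<le> b ^ Suc r"
    using assms(1) by simp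
  with r have xn: "x + n = v + b ^ Suc r * 1" and v: "v < b ^ Suc r"
    unfolding n_def by linarith+
  have bv: "v + (b - 1) * v = b * v"
    using assms(1) by (simp add: diff_mult_distrib)
  have yn: "y + n = d + b * (v + b ^ r * 1)"
    using xn bv assms(3) by (simp add: algebra_simps)
  have "S c b (y + n) = d\<^sup>2 + (S c b v + S 0 b 1)"
    unfolding yn using S_rec [OF assms(1,2), of c "v + b ^ r * 1"] S_add_high [OF assms(1), of v r c 1] r by simp
  moreover have "S c b (x + n) = S c b v + S 0 b 1"
    unfolding xn by (rule S_add_high [OF assms(1) v])
  ultimately show ?thesis by (intro exI [of _ n]) simp
qed

text \<open>Shift so that the larger number becomes \<open>(d + 1) * b ^ r\<close>; the next digit \<open>d\<close> of the smaller
  one then controls the difference of the images modulo \<open>b - 1\<close>.\<close>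

lemma ex_shift_S_cong:
  assumes "odd b" and "b \<ge> 3" and "x < y" and "even (int y - int x - e)"
  shows "\<exists>n. (int (b - 1)) dvd (int (S c b (y + n)) - int (S c b (x + n)) - e)"
proof -
  have b2: "b \<ge> 2" using assms(2) by simp
  obtain r where r: "y < b ^ r"
    using ex_power_gt_nat [OF b2] by blast
  define z where "z = b ^ r - (y - x)"
  have z: "z < b ^ r" "z + y = b ^ r + x"
    using r assms(3) unfolding z_def by auto
  define s where "s = int (S 0 b z)"
  have "even s \<longleftrightarrow> even z"
    using even_S_0_iff [OF assms(1) b2] unfolding s_def by simp
  moreover have "even (z + y) \<longleftrightarrow> \<not> even x"
    using assms(1) unfolding z(2) by simp
  \<comment> \<open>The images will differ by \<open>2 * d + 1 - s\<close>, so \<open>2 * d\<close>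
    must be congruent to \<open>e + s - 1\<close> modulo the even number \<open>b - 1\<close>; this
    needs evenness.\<close>
  ultimately have "even (e + s - 1)"
    using assms(4) by (auto simp: even_add)
  then obtain f where f: "e + s - 1 = 2 * f" by blast
  from assms(1) obtain h where h: "b = 2 * h + 1" by (auto elim: oddE)
  with assms(2) have "h > 0" by simp
  \<comment> \<open>Only \<open>f\<close> modulo \<open>h\<close>, half of \<open>b - 1\<close>,
    matters; reducing it ensures that \<open>Suc d\<close> is still a digit.\<close>
  define d where "d = nat (f mod int h)"
  have d: "int d = f mod int h"
    using \<open>h > 0\<close> unfolding d_def by simp
  then have "int d < int h"
    using \<open>h > 0\<close> by simp
  then have db: "Suc d < b" "d < b"
    using h by auto
  define n where "n = Suc d * b ^ r - y"
  have yn: "y + n = 0 + b ^ r * Suc d"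
    using r unfolding n_def by (simp add: mult.commute trans_le_add1)
  have xn: "x + n = z + b ^ r * d"
    using yn z(2) by simp
  have "S c b (y + n) = c + (Suc d)\<^sup>2"
    unfolding yn using S_add_high [OF b2, of 0 r c "Suc d"] S_digit [OF b2 db(1), of 0] b2
    by (simp add: S_0)
  moreover have "S c b (x + n) = c + S 0 b z + d\<^sup>2"
    unfolding xn using S_add_high [OF b2 z(1), of c d] S_digit [OF b2 db(2), of 0] S_eq_add [of c b z]
    by simp
  ultimately have "int (S c b (y + n)) - int (S c b (x + n)) - e = 2 * (int d - f)"
    using f unfolding s_def by (simp add: power2_eq_square algebra_simps)
  moreover have "int h dvd int d - f"
    unfolding d by (simp add: mod_eq_dvd_iff [symmetric])
  then have "2 * int h dvd 2 * (int d - f)"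
    by (rule mult_dvd_mono [OF dvd_refl])
  ultimately show ?thesis using h by (intro exI [of _ n]) simp
qed

text \<open>Equal parity permits first images congruent modulo \<open>b - 1\<close>. Their
  difference is then \<open>(b - 1) * v\<close>, and a second shift that appends the digit 0 to
  \<open>v\<close> equates the next images.\<close>

lemma merge_same_parity:
  assumes "odd b" and "b \<ge> 3" and "x < y" and "even (x + y)"
  shows "\<exists>n m. S c b (S c b (x + n) + m) = S c b (S c b (y + n) + m)"
proof -
  have "even (int y - int x - 0)"
    using assms(4) by (simp flip: of_nat_add)
  from ex_shift_S_cong [OF assms(1-3) this] obtain n
    where n: "int (b - 1) dvd int (S c b (y + n)) - int (S c b (x + n))"
    by auto
  have *: "\<exists>m. S c b (p + m) = S c b (q + m)"
    if "p \<le> q" "int (b - 1) dvd int q - int p" for p q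
  proof -
    have "int (b - 1) dvd int (q - p)"
      using that by (simp add: of_nat_diff)
    then obtain v where "q - p = (b - 1) * v"
      unfolding int_dvd_int_iff by (auto elim: dvdE)
    with that(1) have "q = p + (b - 1) * v + 0" by simp
    from ex_shift_S_diff [OF _ _ this, of c] assms(2)
    obtain m where "S c b (q + m) = S c b (p + m)" by auto
    then show ?thesis by metis
  qed
  show ?thesis
    using * [of "S c b (x + n)" "S c b (y + n)"] * [of "S c b (y + n)" "S c b (x + n)"] n
    by (metis dvd_diff_commute nat_le_linear)
qed

section \<open>Reduction of finite sets to one consecutive pair\<close>

text \<open>A block \<open>q\<close> with sum of squares \<open>a - c\<close> is put in front of the
  last digits 0 and 1, to which the shift brings \<open>t\<close> and \<open>t + 1\<close>.\<close>

lemma good_consecutive: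
  assumes "b \<ge> 2" and "c < a" and "attracted c b u a" and "attracted c b u (a + 1)"
  shows "good c b u {t, t + 1}"
proof -
  obtain q where q: "S 0 b q = a - c"
    using ex_S_0_eq [OF assms(1)] by blast
  with assms(2) have "q > 0"
    by (cases "q = 0") (auto simp: S_0)
  obtain r where r: "t + 1 < b ^ r"
    using ex_power_gt_nat [OF assms(1)] by blast
  have "b ^ r \<le> b ^ r * q"
    using \<open>q > 0\<close> by simp
  with r have n: "t + (b ^ r * q - t) = b ^ r * q" "b ^ r * q - t > 0" "b ^ r * q > 0"
    by linarith+
  have "S c b (b ^ r * q) = a"
    using S_add_high [OF assms(1), of 0 r c q] r q assms(1,2) by (simp add: S_0)
  then have 1: "attracted c b u (b ^ r * q)"
    using assms(3) n(3) by (auto intro: attracted_S)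
  have "S c b (1 + b ^ r * q) = a + 1"
    using S_add_high [OF assms(1), of 1 r c q] S_digit [of b 1 c] r q assms(1,2) by simp
  then have 2: "attracted c b u (1 + b ^ r * q)"
    using assms(4) by (auto intro: attracted_S)
  have "t + 1 + (b ^ r * q - t) = 1 + b ^ r * q"
    using n(1) by simp
  with 1 2 n(1,2) show ?thesis
    unfolding good_def by (intro exI [of _ "b ^ r * q - t"]) auto
qed

text \<open>A first shift makes the difference of the images 1 modulo \<open>b - 1\<close>. Which
  image is larger decides whether \<open>plus\<close> or \<open>minus\<close> finishes.\<close>

lemma good_opposite_parity:
  assumes "odd b" and "b \<ge> 3" and "odd (x + y)" and consec: "\<And>t. good c b u {t, t + 1}"
  shows "good c b u {x, y}"
proof -
  have b2: "b \<ge> 2" using assms(2) by simp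
  have plus: "good c b u {p, q}" if eq: "q = p + (b - 1) * v + 1" for p q v
  proof -
    obtain n where "S c b (q + n) = S c b (p + n) + 1"
      using ex_shift_S_diff [OF b2 _ eq, of c] b2 by auto
    with consec have "good c b u ((\<lambda>t. S c b (t + n)) ` {p, q})" by simp
    then show ?thesis by (rule good_step [OF b2, rotated]) simp
  qed
  \<comment> \<open>The appended digit \<open>b - 2\<close> has square 1 modulo
    \<open>b - 1\<close>, so the images are in the situation of \<open>plus\<close>.\<close>
  have minus: "good c b u {p, q}" if eq: "q = p + (b - 1) * v + (b - 2)" for p q v
  proof -
    obtain n where n: "S c b (q + n) = S c b (p + n) + (b - 2)\<^sup>2"
      using ex_shift_S_diff [OF b2 _ eq, of c] b2 by auto
    obtain k where k: "b = k + 3"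
      using assms(2) by (metis le_add_diff_inverse2)
    have "(b - 2)\<^sup>2 = (b - 1) * (b - 3) + 1"
      unfolding k by (simp add: power2_eq_square algebra_simps)
    with n have "S c b (q + n) = S c b (p + n) + (b - 1) * (b - 3) + 1"
      by simp
    from plus [OF this] have "good c b u ((\<lambda>t. S c b (t + n)) ` {p, q})" by simp
    then show ?thesis by (rule good_step [OF b2, rotated]) simp
  qed
  have less: "good c b u {p, q}" if "p < q" "odd (p + q)" for p q
  proof -
    have "even (int q - int p - 1)"
      using that(2) by (simp add: even_add)
    from ex_shift_S_cong [OF assms(1,2) that(1) this] obtain n
      where n: "int (b - 1) dvd int (S c b (q + n)) - int (S c b (p + n)) - 1"
      by blast
    define q' where "q' = S c b (q + n)"
    define p' where "p' = S c b (p + n)"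
    have "good c b u {p', q'}"
    proof (cases "p' < q'")
      case True
      then have "int (q' - p' - 1) = int q' - int p' - 1"
        by (simp add: of_nat_diff)
      then have "int (b - 1) dvd int (q' - p' - 1)"
        using n unfolding p'_def q'_def by metis
      then obtain v where "q' - p' - 1 = (b - 1) * v"
        unfolding int_dvd_int_iff by (auto elim: dvdE)
      with True have "q' = p' + (b - 1) * v + 1" by simp
      then show ?thesis by (rule plus)
    next
      case False
      then have "int (p' - q' + 1) = - (int q' - int p' - 1)"
        by (simp add: of_nat_diff)
      then have "int (b - 1) dvd int (p' - q' + 1)"
        using n unfolding p'_def q'_def by (metis dvd_minus_iff)
      then obtain w where w: "p' - q' + 1 = (b - 1) * w"
        unfolding int_dvd_int_iff by (auto elim: dvdE)
      then obtain v where "w = Suc v" by (cases w) auto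
      with w False assms(2) have "p' = q' + (b - 1) * v + (b - 2)" by simp
      from minus [OF this] show ?thesis by (simp add: insert_commute)
    qed
    then have "good c b u ((\<lambda>t. S c b (t + n)) ` {p, q})"
      unfolding p'_def q'_def by simp
    then show ?thesis by (rule good_step [OF b2, rotated]) simp
  qed
  from assms(3) consider "x < y" | "y < x"
    by (cases x y rule: linorder_cases) auto
  then show ?thesis
    using less [of x y] less [of y x] assms(3)
    by cases (simp_all add: insert_commute add.commute)
qed

lemma good_finite:
  assumes "odd b" and "b \<ge> 3" and consec: "\<And>t. good c b u {t, t + 1}" and "finite T"
  shows "good c b u T"
  using assms(4)
proof (induction "card T" arbitrary: T rule: less_induct)
  case less
  have b2: "b \<ge> 2" using assms(2) by simp
  show ?case
  proof (cases "\<exists>x\<in>T. \<exists>y\<in>T. x < y \<and> even (x + y)")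
    case True
    then obtain x y where xy: "x \<in> T" "y \<in> T" "x < y" "even (x + y)" by blast
    from merge_same_parity [OF assms(1,2) xy(3,4)] obtain n m
      where nm: "S c b (S c b (x + n) + m) = S c b (S c b (y + n) + m)" by blast
    \<comment> \<open>Two rounds of shifting and applying \<open>S\<close> identify \<open>x\<close>
      and \<open>y\<close>; the two uses of \<open>good_step\<close> below undo them.\<close>
    define F where "F = (\<lambda>t. S c b (S c b (t + n) + m))"
    have "\<not> inj_on F T"
      using nm xy unfolding F_def inj_on_def by auto
    then have "card (F ` T) < card T"
      using less.prems card_image_le [of T F] eq_card_imp_inj_on [of T F]
      by (simp add: le_less) blast
    from less.hyps [OF this] less.prems
    have "good c b u ((\<lambda>t. S c b (t + m)) ` (\<lambda>t. S c b (t + n)) ` T)"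
      unfolding F_def by (simp add: image_image)
    from good_step [OF b2 _ this] less.prems
    show ?thesis by (auto intro: good_step [OF b2])
  next
    case False
    then have eq: "x = y" if "x \<in> T" "y \<in> T" "even (x + y)" for x y
      using that by (metis add.commute linorder_neqE_nat)
    have "\<exists>x y. odd (x + y) \<and> T \<subseteq> {x, y}"
    proof (cases "\<exists>x\<in>T. \<exists>y\<in>T. x \<noteq> y")
      case True
      then obtain x y where xy: "x \<in> T" "y \<in> T" "x \<noteq> y" by blast
      with eq have "odd (x + y)" by blast
      moreover have "T \<subseteq> {x, y}"
      proof
        fix z assume "z \<in> T"
        with xy eq [of z x] eq [of z y] \<open>odd (x + y)\<close> show "z \<in> {x, y}"
          by auto
      qed
      ultimately show ?thesis by blast
    next
      case False
      \<comment> \<open>An empty or one-element set is padded to a pair of opposite parity.\<close>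
      then obtain x where "T \<subseteq> {x, Suc x}" by blast
      then show ?thesis by (intro exI [of _ x] exI [of _ "Suc x"]) simp
    qed
    with good_opposite_parity [OF assms(1,2) _ consec] show ?thesis
      by (blast intro: good_subset)
  qed
qed

lemma ex_consecutive_attracted:
  assumes "odd b" and "b \<ge> 3"
    and "c < a" and "attracted c b u a" and "attracted c b u (a + 1)"
  shows "\<exists>a>0. \<forall>i<N. attracted c b u (a + i)"
proof -
  have "good c b u {t, t + 1}" for t
    using assms by (intro good_consecutive) auto
  from good_finite [OF assms(1,2) this, of "{..<N}"] show ?thesis
    unfolding good_def by (auto simp: add.commute)
qed

section \<open>Bounds for periodic points\<close>

text \<open>A digit's square is at most \<open>b - 1\<close> times the digit, and the digit sum is
  at most \<open>a\<close>.\<close>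

lemma S_0_le: "b \<ge> 2 \<Longrightarrow> S 0 b a \<le> (b - 1) * a"
proof (induction a rule: less_induct)
  case (less a)
  show ?case
  proof (cases "a = 0")
    case False
    define q r where "q = a div b" and "r = a mod b"
    then have a: "a = r + b * q" and "r < b" and "q < a"
      using False less.prems by simp_all
    have "S 0 b a = r\<^sup>2 + S 0 b q"
      unfolding a by (rule S_rec [OF less.prems \<open>r < b\<close>])
    also have "\<dots> \<le> (b - 1) * r + (b - 1) * (b * q)"
    proof (rule add_mono)
      show "r\<^sup>2 \<le> (b - 1) * r"
        using \<open>r < b\<close> by (auto simp: power2_eq_square)
      have "q \<le> b * q"
        using less.prems by simp
      then have "(b - 1) * q \<le> (b - 1) * (b * q)"
        by (rule mult_le_mono2)
      with less.IH [OF \<open>q < a\<close> less.prems] show "S 0 b q \<le> (b - 1) * (b * q)"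
        by linarith
    qed
    finally show ?thesis unfolding a by (simp add: distrib_left)
  qed (simp add: S_0)
qed

text \<open>The two lowest digits contribute boundedly, while the remaining quotient
  \<open>q\<close> adds \<open>b * b * q\<close> to \<open>a\<close> but at most
  \<open>(b - 1) * q\<close> to the image. For \<open>q\<close> at least 4 the image is below
  \<open>a\<close>, otherwise below the constant.\<close>

lemma S_less_max:
  assumes "b \<ge> 3" and "c \<le> 9"
  shows "S c b a < max a (2 * b\<^sup>2 + 10)"
proof -
  obtain k where k: "b = k + 3"
    using assms(1) by (metis le_add_diff_inverse2)
  have b2: "b \<ge> 2" using assms(1) by simp
  define q r s where "q = a div b div b" and "r = a mod b" and "s = a div b mod b"
  then have "a = r + b * (s + b * q)" and rs: "r < b" "s < b"
    using assms(1) by simp_all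
  note a = this(1)
  have "S c b a = c + (r\<^sup>2 + (s\<^sup>2 + S 0 b q))"
    unfolding a S_eq_add [of c] using S_rec [OF b2] rs by simp
  also have "\<dots> \<le> 9 + ((b - 1)\<^sup>2 + ((b - 1)\<^sup>2 + (b - 1) * q))"
    using assms(2) rs S_0_le [OF b2] by (intro add_mono power_mono) simp_all
  finally have S: "S c b a \<le> 9 + 2 * (k + 2)\<^sup>2 + (k + 2) * q"
    unfolding k by simp
  show ?thesis
  proof (cases "q \<le> 3")
    case True
    then have "(k + 2) * q \<le> (k + 2) * 3"
      by (rule mult_le_mono2)
    with S have "S c b a < 2 * b\<^sup>2 + 10"
      unfolding k by (simp add: power2_eq_square algebra_simps)
    then show ?thesis by simp
  next
    case False
    then obtain j where q: "q = j + 4"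
      by (metis le_add_diff_inverse2 not_less_eq_eq eval_nat_numeral(2) semiring_norm(26-28))
    have "9 + 2 * (k + 2)\<^sup>2 + (k + 2) * q < b * (b * q)"
      unfolding k q by (simp add: power2_eq_square algebra_simps)
    also have "\<dots> \<le> a"
      unfolding a by (simp add: algebra_simps)
    finally show ?thesis using S by simp
  qed
qed

text \<open>From a larger \<open>u\<close> the orbit would drop below \<open>u\<close> at the first
  step and stay there, never returning.\<close>

lemma U_set_less:
  assumes "b \<ge> 3" and "c \<le> 9" and "u \<in> U_set c b"
  shows "u < 2 * b\<^sup>2 + 10"
proof (rule ccontr)
  assume "\<not> ?thesis"
  then have *: "max a (2 * b\<^sup>2 + 10) \<le> u" if "a \<le> u" for a
    using that by simp
  have "(S c b ^^ Suc k) u < u" for k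
  proof (induction k)
    case 0
    show ?case using S_less_max [OF assms(1,2), of u] * [of u] by simp
  next
    case (Suc k)
    then show ?case
      using S_less_max [OF assms(1,2), of "(S c b ^^ Suc k) u"] * [of "(S c b ^^ Suc k) u"] by simp
  qed
  moreover from assms(3) obtain m where "m > 0" "(S c b ^^ m) u = u"
    unfolding U_set_def by blast
  ultimately show False by (metis gr0_implies_Suc less_irrefl)
qed

text \<open>The predecessor on the cycle is a preimage, so taking images of a superset of
  \<open>U_set\<close> loses no periodic point.\<close>

lemma U_set_preimage:
  assumes "c > 0" and "u \<in> U_set c b"
  shows "\<exists>v\<in>U_set c b. S c b v = u"
proof -
  from assms(2) obtain k where k: "(S c b ^^ Suc k) u = u" and "u > 0"
    unfolding U_set_def by (auto simp: gr0_conv_Suc)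
  define v where "v = (S c b ^^ k) u"
  have "S c b v = u"
    using k unfolding v_def by simp
  then have "(S c b ^^ Suc k) v = v"
    unfolding v_def by (simp add: funpow_swap1)
  moreover have "v > 0"
    using \<open>u > 0\<close> assms(1) S_eq_add [of c b] unfolding v_def by (cases k) auto
  ultimately show ?thesis
    using \<open>S c b v = u\<close> unfolding U_set_def by blast
qed

section \<open>Verification by computation\<close>

fun reaches :: "nat \<Rightarrow> nat \<Rightarrow> nat \<Rightarrow> nat \<Rightarrow> nat \<Rightarrow> bool" where
  "reaches c b u 0 a \<longleftrightarrow> a = u"
| "reaches c b u (Suc k) a \<longleftrightarrow> a = u \<or> reaches c b u k (S c b a)"

definition images :: "nat \<Rightarrow> nat \<Rightarrow> nat \<Rightarrow> nat list" where
  "images c b k = ((\<lambda>xs. remdups (map (S c b) xs)) ^^ k) [0..<2 * b\<^sup>2 + 10]"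

text \<open>Periodic points survive in every iterated image of the initial segment. After 15 rounds only
  periodic points are left, and each of the pairs below is attracted within 13 steps.\<close>

definition certificate :: "nat \<Rightarrow> nat \<Rightarrow> nat list \<Rightarrow> bool" where
  "certificate c b ws \<longleftrightarrow>
     list_all (\<lambda>u. list_ex (\<lambda>a. c < a \<and> reaches c b u 13 a \<and> reaches c b u 13 (a + 1)) ws)
       (images c b 15)"

lemma attracted_reaches: "reaches c b u k a \<Longrightarrow> a > 0 \<Longrightarrow> c > 0 \<Longrightarrow> attracted c b u a"
proof (induction k arbitrary: a)
  case 0
  then have "(S c b ^^ 0) a = u" by simp
  with 0 show ?case unfolding attracted_def by blast
next
  case (Suc k)
  show ?case
  proof (cases "a = u")
    case True
    then have "(S c b ^^ 0) a = u" by simp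
    with Suc.prems show ?thesis unfolding attracted_def by blast
  next
    case False
    with Suc S_eq_add [of c b a] show ?thesis by (auto intro: attracted_S)
  qed
qed

lemma U_set_images:
  assumes "b \<ge> 3" and "0 < c" and "c \<le> 9"
  shows "u \<in> U_set c b \<Longrightarrow> u \<in> set (images c b k)"
proof (induction k arbitrary: u)
  case 0
  then show ?case using U_set_less [OF assms(1,3)] by (simp add: images_def)
next
  case (Suc k)
  from U_set_preimage [OF assms(2) Suc.prems] obtain v where "v \<in> U_set c b" "S c b v = u"
    by blast
  with Suc.IH [of v] show ?case by (auto simp: images_def)
qed

lemma certificate_consecutive:
  assumes "certificate c b ws" and "odd b" and "b \<ge> 3" and "0 < c" and "c \<le> 9" and "u \<in> U_set c b"
  shows "\<exists>a>0. \<forall>i<N. attracted c b u (a + i)"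
proof -
  from assms(1) U_set_images [OF assms(3-6), of 15] obtain a
    where a: "c < a" "reaches c b u 13 a" "reaches c b u 13 (a + 1)"
    unfolding certificate_def list_all_iff list_ex_iff by blast
  then have "attracted c b u a" "attracted c b u (a + 1)"
    using assms(4) by (auto intro!: attracted_reaches simp del: reaches.simps)
  from ex_consecutive_attracted [OF assms(2,3) a(1) this] show ?thesis .
qed

text \<open>Entries are the lower members of attracted pairs. An orbit enters only one cycle, so
  several cycles require several entries.\<close>

lemma certificates:
  "certificate 1 3 [2]"
  "certificate 3 3 [4]"
  "certificate 5 3 [10, 53, 1115]"
  "certificate 7 3 [8]"
  "certificate 9 3 [10]"
  "certificate 1 5 [2]"
  "certificate 3 5 [4]"
  "certificate 5 5 [6]"
  "certificate 7 5 [8]"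
  "certificate 9 5 [10]"
  "certificate 1 7 [4, 8]"
  "certificate 3 7 [4, 10]"
  "certificate 5 7 [6, 9, 17]"
  "certificate 7 7 [8]"
  "certificate 9 7 [10]"
  "certificate 1 9 [2]"
  "certificate 3 9 [4]"
  "certificate 5 9 [6, 12, 73, 66878]"
  "certificate 7 9 [8, 20, 23, 31]"
  "certificate 9 9 [10, 21]"
  by code_simp+

theorem theorem4p1:
  fixes c b u :: nat
  assumes "odd c" and "1 \<le> c" and "c \<le> 9"
    and "odd b" and "3 \<le> b" and "b \<le> 9"
    and "u \<in> U_set c b"
  shows "\<forall>N>0. \<exists>a>0. \<forall>i<N. attracted c b u (a + i)"
proof -
  have "c \<in> {1, 3, 5, 7, 9}"
    using assms(1-3) by (simp; presburger)
  moreover have "b \<in> {3, 5, 7, 9}"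
    using assms(4-6) by (simp; presburger)
  ultimately obtain ws where "certificate c b ws"
    using certificates by (elim insertE emptyE; simp; blast)
  from certificate_consecutive [OF this assms(4,5) _ assms(3,7)] assms(2) show ?thesis by simp
qed

end
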